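(* Let $m,K\in\mathbb N$ with $m>K$, and let $s=\lceil m/K\rceil-1$. Consider the online algorithm for Online Makespan Scheduling under Scenarios which, upon revelation of each job $j$, assigns $j$ to a machine $i$ that (with respect to the loads of jobs $1,\dots,j-1$) is $s$-favorable with respect to every scenario $k$ with $j\in S_k$. This algorithm is $\left(\frac{m-1}{\lceil m/K\rceil}+1\right)$-competitive.
   Context: Online Makespan Scheduling under Scenarios with $m$ machines and $K$ scenarios (both known in advance): an instance consists of $n$ jobs with processing times $p_j\ge0$ and scenarios $S_1,\dots,S_K\subseteq[n]$; jobs are revealed in order $1,\dots,n$, and on revelation of job $j$ the algorithm learns $p_j$ and which scenarios contain $j$, and must irrevocably assign $j$ to a machine $\tau(j)\in[m]$. With $J_i=\tau^{-1}(i)$ and $p(S)=\sum_{j\in S}p_j$, the makespan is $\max_{k}\max_i p(J_i\cap S_k)$; an algorithm is $\rho$-competitive if its makespan is always at most $\rho$ times the offline optimum (minimum makespan over all partitions of $[n]$ into $m$ machines). For $s\in\{0,\dots,m-1\}$ and a scenario $k$, a machine $i$ is $s$-favorable with respect to the $k$-th scenario (for the current partial assignment) if there are at least $s$ machines $i'\neq i$ with $p(J_{i'}\cap S_k)\ge p(J_i\cap S_k)$. A machine that is $(\lceil m/K\rceil-1)$-favorable with respect to all scenarios always exists; ties between suitable machines are broken arbitrarily. *)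

theory Defs
  imports Complex_Main "HOL-Library.FuncSet"
begin

text \<open>
  Jobs are \<open>{1..n}\<close>, machines \<open>{1..m}\<close>, scenarios \<open>{1..K}\<close>; an instance is given by \<open>n\<close>, the
  processing times \<open>p\<close> and the scenarios \<open>S 1, \<dots>, S K\<close>.
\<close>

definition valid_instance :: "nat \<Rightarrow> nat \<Rightarrow> (nat \<Rightarrow> real) \<Rightarrow> (nat \<Rightarrow> nat set) \<Rightarrow> bool" where
  "valid_instance K n p S \<longleftrightarrow> (\<forall>j\<in>{1..n}. 0 \<le> p j) \<and> (\<forall>k\<in>{1..K}. S k \<subseteq> {1..n})"

definition assigned_jobs :: "nat \<Rightarrow> (nat \<Rightarrow> nat) \<Rightarrow> nat \<Rightarrow> nat set" where
  "assigned_jobs n \<tau> i = {j \<in> {1..n}. \<tau> j = i}"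

text \<open>With \<open>n\<close> replaced by \<open>j - 1\<close> this is the load just before job \<open>j\<close> is assigned.\<close>

definition load ::
  "nat \<Rightarrow> (nat \<Rightarrow> real) \<Rightarrow> (nat \<Rightarrow> nat set) \<Rightarrow> (nat \<Rightarrow> nat) \<Rightarrow> nat \<Rightarrow> nat \<Rightarrow> real" where
  "load n p S \<tau> k i = sum p (assigned_jobs n \<tau> i \<inter> S k)"

definition makespan ::
  "nat \<Rightarrow> nat \<Rightarrow> nat \<Rightarrow> (nat \<Rightarrow> real) \<Rightarrow> (nat \<Rightarrow> nat set) \<Rightarrow> (nat \<Rightarrow> nat) \<Rightarrow> real" where
  "makespan m K n p S \<tau> = (MAX k\<in>{1..K}. MAX i\<in>{1..m}. load n p S \<tau> k i)"

definition opt :: "nat \<Rightarrow> nat \<Rightarrow> nat \<Rightarrow> (nat \<Rightarrow> real) \<Rightarrow> (nat \<Rightarrow> nat set) \<Rightarrow> real" where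
  "opt m K n p S = (MIN \<tau>\<in>{1..n} \<rightarrow>\<^sub>E {1..m}. makespan m K n p S \<tau>)"

text \<open>
  An online algorithm (for fixed \<open>m\<close> and \<open>K\<close>) maps the data revealed so far, i.e. the list of
  pairs (processing time, set of scenarios containing the job) of the jobs \<open>1, \<dots>, j\<close>, to the
  machine for job \<open>j\<close>. Its own earlier decisions are determined by the prefixes of that list, and
  it does not see \<open>n\<close>.
\<close>

type_synonym online_algorithm = "(real \<times> nat set) list \<Rightarrow> nat"

definition revealed ::
  "nat \<Rightarrow> (nat \<Rightarrow> real) \<Rightarrow> (nat \<Rightarrow> nat set) \<Rightarrow> nat \<Rightarrow> (real \<times> nat set) list" where
  "revealed K p S j = map (\<lambda>i. (p i, {k \<in> {1..K}. i \<in> S k})) [1..<Suc j]"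

definition online_assignment ::
  "nat \<Rightarrow> online_algorithm \<Rightarrow> (nat \<Rightarrow> real) \<Rightarrow> (nat \<Rightarrow> nat set) \<Rightarrow> nat \<Rightarrow> nat" where
  "online_assignment K A p S j = A (revealed K p S j)"

definition competitive :: "nat \<Rightarrow> nat \<Rightarrow> real \<Rightarrow> online_algorithm \<Rightarrow> bool" where
  "competitive m K \<rho> A \<longleftrightarrow>
     (\<forall>n p S. valid_instance K n p S \<longrightarrow>
        online_assignment K A p S \<in> {1..n} \<rightarrow> {1..m} \<and>
        makespan m K n p S (online_assignment K A p S) \<le> \<rho> * opt m K n p S)"

definition favorable ::
  "nat \<Rightarrow> nat \<Rightarrow> (nat \<Rightarrow> real) \<Rightarrow> (nat \<Rightarrow> nat set) \<Rightarrow> (nat \<Rightarrow> nat) \<Rightarrow> nat \<Rightarrow> nat \<Rightarrow> nat \<Rightarrow> bool" where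
  "favorable m n p S \<tau> s k i \<longleftrightarrow>
     s \<le> card {i' \<in> {1..m}. i' \<noteq> i \<and> load n p S \<tau> k i' \<ge> load n p S \<tau> k i}"

text \<open>
  The rule leaves the choice between several suitable machines open; \<open>A\<close> ranges over all possible
  ways of breaking ties.
\<close>

definition favorable_algorithm :: "nat \<Rightarrow> nat \<Rightarrow> nat \<Rightarrow> online_algorithm \<Rightarrow> bool" where
  "favorable_algorithm m K s A \<longleftrightarrow>
     (\<forall>n p S. valid_instance K n p S \<longrightarrow>
        (let \<tau> = online_assignment K A p S in
          \<forall>j\<in>{1..n}. \<tau> j \<in> {1..m} \<and>
            (\<forall>k\<in>{1..K}. j \<in> S k \<longrightarrow> favorable m (j - 1) p S \<tau> s k (\<tau> j))))"

text \<open>The rule can always be followed.\<close>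

lemma card_not_favorable_le:
  "card {i \<in> {1..m}. \<not> favorable m n p S \<tau> s k i} \<le> s"
proof (rule ccontr)
  let ?B = "{i \<in> {1..m}. \<not> favorable m n p S \<tau> s k i}"
  assume "\<not> card ?B \<le> s"
  then have B: "s < card ?B" by simp
  then have "0 < card ?B" by linarith
  then have ne: "?B \<noteq> {}" unfolding card_gt_0_iff by (rule conjunct1)
  have fin: "finite ?B" by simp
  define i where "i = arg_min_on (load n p S \<tau> k) ?B"
  have i: "i \<in> ?B" unfolding i_def by (rule arg_min_if_finite(1)[OF fin ne])
  have le: "load n p S \<tau> k i \<le> load n p S \<tau> k i'" if "i' \<in> ?B" for i'
    unfolding i_def by (rule arg_min_least[OF fin ne that])
  let ?C = "{i' \<in> {1..m}. i' \<noteq> i \<and> load n p S \<tau> k i' \<ge> load n p S \<tau> k i}"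
  have "?B - {i} \<subseteq> ?C" using le by auto
  then have "card (?B - {i}) \<le> card ?C" by (intro card_mono) auto
  moreover have "card (?B - {i}) = card ?B - 1" using i by (simp add: card_Diff_singleton)
  ultimately have "s \<le> card ?C" using B by linarith
  then show False using i by (simp add: favorable_def)
qed

lemma favorable_machine_exists:
  assumes "1 \<le> K" "K < m" "int s = \<lceil>real m / real K\<rceil> - 1"
  shows "\<exists>i\<in>{1..m}. \<forall>k\<in>{1..K}. favorable m n p S \<tau> s k i"
proof (rule ccontr)
  assume "\<not> ?thesis"
  then have "{1..m} \<subseteq> (\<Union>k\<in>{1..K}. {i \<in> {1..m}. \<not> favorable m n p S \<tau> s k i})" by auto
  then have "m \<le> card (\<Union>k\<in>{1..K}. {i \<in> {1..m}. \<not> favorable m n p S \<tau> s k i})"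
    using card_mono[of "\<Union>k\<in>{1..K}. {i \<in> {1..m}. \<not> favorable m n p S \<tau> s k i}" "{1..m}"] by simp
  also have "\<dots> \<le> (\<Sum>k\<in>{1..K}. card {i \<in> {1..m}. \<not> favorable m n p S \<tau> s k i})"
    by (rule card_UN_le) simp
  also have "\<dots> \<le> (\<Sum>k\<in>{1..K}. s)" by (intro sum_mono card_not_favorable_le)
  finally have "m \<le> K * s" by simp
  then have "real m \<le> real K * real s" by (simp flip: of_nat_mult)
  moreover have "real s < real m / real K" using assms(3) by linarith
  then have "real K * real s < real m" using assms(1) by (simp add: field_simps)
  ultimately show False by simp
qed

end

theory Submission
  imports Defs
begin

text \<open>
  Let \<open>j\<close> be the last job of scenario \<open>k\<close> put on machine \<open>i\<close>, let \<open>L\<close> be the load of \<open>i\<close> in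
  scenario \<open>k\<close> just before, and put \<open>c = s + 1 = \<lceil>m / K\<rceil>\<close>. Since \<open>i\<close> was \<open>s\<close>-favorable, \<open>c\<close> machines
  had load at least \<open>L\<close>, so \<open>c L + p\<^sub>j \<le> p(S\<^sub>k) \<le> m OPT\<close>. Together with \<open>p\<^sub>j \<le> OPT\<close> the final load
  satisfies \<open>L + p\<^sub>j \<le> m OPT / c + (1 - 1 / c) p\<^sub>j \<le> ((m - 1) / c + 1) OPT\<close>.
\<close>

lemma load_nonneg:
  assumes "\<forall>j\<in>{1..n}. 0 \<le> p j"
  shows "0 \<le> load n p S \<tau> k i"
  unfolding load_def assigned_jobs_def using assms by (intro sum_nonneg) auto

text \<open>The fibres of \<open>\<tau>\<close> over \<open>{1..m}\<close> partition the jobs, so no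
  job of the scenario is lost or counted twice.\<close>

lemma sum_load:
  assumes "\<tau> \<in> {1..n} \<rightarrow> {1..m}"
  shows "(\<Sum>i\<in>{1..m}. load n p S \<tau> k i) = sum p ({1..n} \<inter> S k)"
proof -
  have "load n p S \<tau> k i = (\<Sum>j | j \<in> {1..n} \<inter> S k \<and> \<tau> j = i. p j)" for i
    unfolding load_def assigned_jobs_def by (rule arg_cong[where f = "sum p"]) auto
  moreover have "\<tau> ` ({1..n} \<inter> S k) \<subseteq> {1..m}"
    using assms by auto
  ultimately show ?thesis
    using sum.group[of "{1..n} \<inter> S k" "{1..m}" \<tau> p] by simp
qed

lemma load_le_makespan:
  assumes "k \<in> {1..K}" "i \<in> {1..m}"
  shows "load n p S \<tau> k i \<le> makespan m K n p S \<tau>"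
proof -
  have "load n p S \<tau> k i \<le> (MAX i\<in>{1..m}. load n p S \<tau> k i)"
    using assms by (intro Max_ge) auto
  also have "\<dots> \<le> makespan m K n p S \<tau>"
    unfolding makespan_def using assms by (intro Max_ge) auto
  finally show ?thesis .
qed

lemma makespan_le:
  assumes "1 \<le> K" "1 \<le> m"
    and "\<And>k i. k \<in> {1..K} \<Longrightarrow> i \<in> {1..m} \<Longrightarrow> load n p S \<tau> k i \<le> B"
  shows "makespan m K n p S \<tau> \<le> B"
  unfolding makespan_def using assms by (auto simp: Max_le_iff)

lemma makespan_bounds:
  assumes "valid_instance K n p S" "\<tau> \<in> {1..n} \<rightarrow> {1..m}" "k \<in> {1..K}"
  shows sum_le_makespan: "sum p ({1..n} \<inter> S k) \<le> real m * makespan m K n p S \<tau>"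
    and job_le_makespan: "\<And>j. j \<in> {1..n} \<Longrightarrow> j \<in> S k \<Longrightarrow> p j \<le> makespan m K n p S \<tau>"
proof -
  have "(\<Sum>i\<in>{1..m}. load n p S \<tau> k i) \<le> (\<Sum>i\<in>{1..m}. makespan m K n p S \<tau>)"
    using assms(3) by (intro sum_mono load_le_makespan)
  then show "sum p ({1..n} \<inter> S k) \<le> real m * makespan m K n p S \<tau>"
    using sum_load[OF assms(2)] by simp
next
  fix j assume j: "j \<in> {1..n}" "j \<in> S k"
  have "p j \<le> load n p S \<tau> k (\<tau> j)"
    unfolding load_def assigned_jobs_def
    using j assms(1) by (intro member_le_sum) (auto simp: valid_instance_def)
  also have "\<dots> \<le> makespan m K n p S \<tau>"
    using assms(2,3) j by (intro load_le_makespan) auto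
  finally show "p j \<le> makespan m K n p S \<tau>" .
qed

text \<open>A minimizer exists because there are finitely many extensional assignments, and at least
  one since m \<ge> 1. Lower bounds on an arbitrary makespan thereby transfer to
  \<open>opt\<close>.\<close>

lemma opt_attained:
  assumes "1 \<le> m"
  obtains \<tau> where "\<tau> \<in> {1..n} \<rightarrow> {1..m}" "opt m K n p S = makespan m K n p S \<tau>"
proof -
  let ?T = "{1..n} \<rightarrow>\<^sub>E {1..m}"
  have "finite ?T" by (intro finite_PiE) auto
  moreover have "?T \<noteq> {}" using assms by (auto simp: PiE_eq_empty_iff)
  ultimately have "opt m K n p S \<in> makespan m K n p S ` ?T"
    unfolding opt_def by (intro Min_in) auto
  then show ?thesis using that by (auto simp: PiE_def)
qed

lemma opt_bounds:
  assumes "valid_instance K n p S" "1 \<le> m" "k \<in> {1..K}"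
  shows sum_le_opt: "sum p ({1..n} \<inter> S k) \<le> real m * opt m K n p S"
    and job_le_opt: "\<And>j. j \<in> {1..n} \<Longrightarrow> j \<in> S k \<Longrightarrow> p j \<le> opt m K n p S"
    and opt_nonneg: "0 \<le> opt m K n p S"
proof -
  obtain \<tau> where \<tau>: "\<tau> \<in> {1..n} \<rightarrow> {1..m}" "opt m K n p S = makespan m K n p S \<tau>"
    using opt_attained[OF assms(2)] .
  show "sum p ({1..n} \<inter> S k) \<le> real m * opt m K n p S"
    using sum_le_makespan[OF assms(1) \<tau>(1) assms(3)] \<tau>(2) by simp
  show "p j \<le> opt m K n p S" if "j \<in> {1..n}" "j \<in> S k" for j
    using job_le_makespan[OF assms(1) \<tau>(1) assms(3) that] \<tau>(2) by simp
  \<comment> \<open>Any load is a nonnegative lower bound, even without jobs; machine 1 exists as m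
    \<ge> 1.\<close>
  have "0 \<le> load n p S \<tau> k 1"
    using assms(1) by (intro load_nonneg) (simp add: valid_instance_def)
  also have "\<dots> \<le> makespan m K n p S \<tau>"
    using assms(2,3) by (intro load_le_makespan) auto
  finally show "0 \<le> opt m K n p S" using \<tau>(2) by simp
qed

lemma favorable_load_le_sum:
  assumes "\<forall>j\<in>{1..n}. 0 \<le> p j" "\<tau> \<in> {1..n} \<rightarrow> {1..m}" "i \<in> {1..m}"
    and "favorable m n p S \<tau> s k i"
  shows "(real s + 1) * load n p S \<tau> k i \<le> sum p ({1..n} \<inter> S k)"
proof -
  let ?L = "load n p S \<tau> k"
  let ?T = "{i' \<in> {1..m}. i' \<noteq> i \<and> ?L i' \<ge> ?L i}"
  \<comment> \<open>Favorability counts only machines other than \<open>i\<close>; adding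
    \<open>i\<close> itself turns s into s + 1.\<close>
  have "(real s + 1) * ?L i \<le> real (card (insert i ?T)) * ?L i"
    using assms(4) load_nonneg[OF assms(1)]
    by (intro mult_right_mono) (auto simp: favorable_def)
  also have "\<dots> \<le> (\<Sum>i'\<in>insert i ?T. ?L i')"
    by (rule sum_bounded_below) auto
  also have "\<dots> \<le> (\<Sum>i'\<in>{1..m}. ?L i')"
    using assms(3) load_nonneg[OF assms(1)] by (intro sum_mono2) auto
  finally show ?thesis using sum_load[OF assms(2)] by simp
qed

lemma favorable_load_bound:
  assumes valid: "valid_instance K n p S" and \<tau>: "\<tau> \<in> {1..n} \<rightarrow> {1..m}"
    and k: "k \<in> {1..K}" and i: "i \<in> {1..m}"
    and fav: "\<And>j. j \<in> {1..n} \<Longrightarrow> j \<in> S k \<Longrightarrow> favorable m (j - 1) p S \<tau> s k (\<tau> j)"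
  shows "load n p S \<tau> k i \<le> ((real m - 1) / (real s + 1) + 1) * opt m K n p S"
proof (cases "assigned_jobs n \<tau> i \<inter> S k = {}")
  case True
  \<comment> \<open>The load is 0, so only the sign of the bound matters; its factor is nonnegative
    because \<open>i\<close> witnesses m \<ge> 1.\<close>
  have "0 \<le> opt m K n p S" using opt_nonneg[OF valid _ k] i by simp
  with True i show ?thesis by (simp add: load_def)
next
  case False
  let ?J = "assigned_jobs n \<tau> i \<inter> S k" and ?OPT = "opt m K n p S"
  have fin: "finite ?J" by (simp add: assigned_jobs_def)
  \<comment> \<open>Jobs put on \<open>i\<close> after \<open>j\<close> lie outside
    \<open>S k\<close> and leave this load unchanged, so favorability is needed only at
    \<open>j\<close>.\<close>
  define j where "j = Max ?J"
  have jJ: "j \<in> ?J" unfolding j_def using fin False by (rule Max_in)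
  then have j: "j \<in> {1..n}" "\<tau> j = i" "j \<in> S k" by (auto simp: assigned_jobs_def)
  have last: "j' \<le> j" if "j' \<in> ?J" for j' unfolding j_def using fin that by (rule Max_ge)
  have m: "1 \<le> m" using i by simp
  have pos: "0 \<le> p j'" if "j' \<in> {1..n}" for j' using valid that by (auto simp: valid_instance_def)
  define L where "L = load (j - 1) p S \<tau> k i"
  have "?J - {j} = assigned_jobs (j - 1) \<tau> i \<inter> S k"
    using last j(1) by (force simp: assigned_jobs_def)
  then have load: "load n p S \<tau> k i = p j + L"
    unfolding L_def load_def using sum.remove[OF fin jJ, of p] by simp
  have "(real s + 1) * L \<le> sum p ({1..j - 1} \<inter> S k)"
    unfolding L_def using j fav[OF j(1,3)] \<tau> i pos
    by (intro favorable_load_le_sum[where m = m]) auto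
  \<comment> \<open>Job \<open>j\<close> is not among the jobs counted so far, so \<open>p j\<close>
    can be added to the volume. This gains the m - 1 in the ratio; without it the numerator would be
    m.\<close>
  moreover have "j \<notin> {1..j - 1} \<inter> S k" using j(1) by auto
  ultimately have "(real s + 1) * L + p j \<le> sum p (insert j ({1..j - 1} \<inter> S k))"
    by simp
  also have "\<dots> \<le> sum p ({1..n} \<inter> S k)"
    using j pos by (intro sum_mono2) auto
  also have "\<dots> \<le> real m * ?OPT" by (rule sum_le_opt[OF valid m k])
  finally have total: "(real s + 1) * L + p j \<le> real m * ?OPT" .
  \<comment> \<open>Of the s + 1 copies of \<open>p j\<close> in (s + 1)(\<open>p j\<close> + L),
    \<open>total\<close> covers one; the other s are bounded by the optimum.\<close>
  have "real s * p j \<le> real s * ?OPT"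
    using job_le_opt[OF valid m k j(1,3)] by (intro mult_left_mono) auto
  with total have "(real s + 1) * (p j + L) \<le> (real m + real s) * ?OPT"
    by (simp add: algebra_simps)
  then have "p j + L \<le> (real m + real s) * ?OPT / (real s + 1)"
    by (simp add: field_simps)
  also have "\<dots> = ((real m - 1) / (real s + 1) + 1) * ?OPT"
    by (simp add: field_simps)
  finally show ?thesis using load by simp
qed

theorem mainTheorem4:
  fixes m K s :: nat and A :: online_algorithm
  assumes "1 \<le> K" and "K < m"
    and "int s = \<lceil>real m / real K\<rceil> - 1"
    and "favorable_algorithm m K s A"
  shows "competitive m K ((real m - 1) / of_int \<lceil>real m / real K\<rceil> + 1) A"
  unfolding competitive_def
proof (intro allI impI)
  fix n p S
  assume valid: "valid_instance K n p S"
  let ?\<tau> = "online_assignment K A p S"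
  have rule: "\<forall>j\<in>{1..n}. ?\<tau> j \<in> {1..m} \<and>
      (\<forall>k\<in>{1..K}. j \<in> S k \<longrightarrow> favorable m (j - 1) p S ?\<tau> s k (?\<tau> j))"
    using assms(4) valid unfolding favorable_algorithm_def Let_def by blast
  then have \<tau>: "?\<tau> \<in> {1..n} \<rightarrow> {1..m}" by blast
  have c: "real_of_int \<lceil>real m / real K\<rceil> = real s + 1" using assms(3) by linarith
  have "makespan m K n p S ?\<tau> \<le> ((real m - 1) / (real s + 1) + 1) * opt m K n p S"
    using assms(1,2) rule
    by (intro makespan_le favorable_load_bound[OF valid \<tau>]) auto
  with \<tau> c show "?\<tau> \<in> {1..n} \<rightarrow> {1..m} \<and> makespan m K n p S ?\<tau>
      \<le> ((real m - 1) / of_int \<lceil>real m / real K\<rceil> + 1) * opt m K n p S"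
    by simp
qed

end
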